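(* Consider the second-order cone program (P): maximize $c^{\top}x$ subject to $Ax=b$, $x\in\mathcal{K}$, and its dual (D): minimize $b^{\top}y$ subject to $A^{\top}y-c\in\mathcal{K}$. Assume that (i) the optimal solution set of (P) is nonempty and compact; and (ii) Slater's constraint qualification holds for (P), i.e. there exists some $z\in\mathbb{R}^n$ such that $z\in\operatorname{int}\mathcal{K}$ and $Az=b$, and the matrix $A$ is of full row rank. Then the sequence $\{y^{(k)}\}$ generated by the dual adaptive LP-Newton method is bounded, and any accumulation point of $\{y^{(k)}\}$ solves (D).
   Context: Problem. Let $A\in\mathbb{R}^{m\times n}$, $b\in\mathbb{R}^{m}$, $c\in\mathbb{R}^{n}$, and $\mathcal{K}=\mathcal{K}^{n_1}\times\cdots\times\mathcal{K}^{n_p}$ with $n_1+\dots+n_p=n$, where $\mathcal{K}^{l}=\{(z_1,\dots,z_l)\in\mathbb{R}^l: z_1\ge (\sum_{j=2}^{l}z_j^2)^{1/2}\}$ for $l\ge 2$ and $\mathcal{K}^1=\{z\in\mathbb{R}:z\ge 0\}$. A vector $x\in\mathbb{R}^n$ is partitioned accordingly as $x=(x^1,\dots,x^p)$, $x^i\in\mathbb{R}^{n_i}$. Notation. $\|\cdot\|$ is the Euclidean norm. For $n_i\ge 2$ let $V_i=\{v\in\mathbb{R}^{n_i-1}:\|v\|\le 1\}$. For $E=\prod_{i=1}^p E_i$ with $E_i\subseteq V_i$, let $\mathcal{K}_E=\{x\in\mathbb{R}^n:(1,(v^i)^{\top})x^i\ge 0\ \text{for all } v^i\in E_i,\ i=1,\dots,p\}$;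 for blocks with $n_i=1$ the corresponding constraint denotes $x^i\ge 0$ by convention. Let $\bar A=\begin{pmatrix}c^{\top}\\ A\end{pmatrix}\in\mathbb{R}^{(1+m)\times n}$, $L=\{(\gamma,b):\gamma\in\mathbb{R}\}\subset\mathbb{R}^{1+m}$, and $\bar A\mathcal{K}_E=\{\bar Ax:x\in\mathcal{K}_E\}$. Adaptive LP-Newton (ALPN) method. Choose initial finite sets $E_i^{(0)}\subseteq V_i$ ($i=1,\dots,p$) such that $\operatorname{argmax}\{c^{\top}x:Ax=b,\ x\in\mathcal{K}_{E^{(0)}}\}\neq\emptyset$, where $E^{(k)}=\prod_i E_i^{(k)}$. Choose an initial point $w^{(0)}=(\gamma^{(0)},b)\in L$ with sufficiently large $\gamma^{(0)}\in\mathbb{R}$. For $k=0,1,2,\dots$: (1) Find the point $\bar w^{(k)}=(\zeta^{(k)},b^{(k)})\in\mathbb{R}\times\mathbb{R}^m$ of $\bar A\mathcal{K}_{E^{(k)}}$ nearest to $w^{(k)}$, and obtain $x^{(k)}\in\mathcal{K}_{E^{(k)}}$ such that $\bar Ax^{(k)}=\bar w^{(k)}$. (2) If $x^{(k)}$ is feasible for (P), return $x^{(k)}$ (stop). (3) Let $w^{(k+1)}=(\gamma^{(k+1)},b)$ be the intersection point of $L$ and $H^{(k)}$, where $H^{(k)}$ is the supporting hyperplane of $\bar A\mathcal{K}_{E^{(k)}}$ at $\bar w^{(k)}$ orthogonal to $w^{(k)}-\bar w^{(k)}$. (4) For each $i=1,\dots,p$, find $v^{i,(k)}\in\operatorname{argmin}_{v^i\in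 V_i}(1,(v^i)^{\top})x^{i,(k)}$, where $x^{i,(k)}$ is the $i$-th block of $x^{(k)}$, and set $E_i^{(k+1)}=E_i^{(k)}\cup\{v^{i,(k)}\}$. Dual adaptive LP-Newton method. Let $\{x^{(k)}\}$ and $\{\gamma^{(k)}\}$ be the sequences generated by the ALPN method. For $k=0,1,2,\dots$: if $\gamma^{(k)}-c^{\top}x^{(k)}\neq0$, set $y^{(k)}=-\dfrac{b-Ax^{(k)}}{\gamma^{(k)}-c^{\top}x^{(k)}}$; else if $Ax^{(k)}\ne b$, break; else set $y^{(k)}=0\in\mathbb{R}^m$. Set $\eta^{(k)}=A^{\top}y^{(k)}-c$. If $(x,y,\eta)=(x^{(k)},y^{(k)},\eta^{(k)})$ satisfies the Karush--Kuhn--Tucker conditions $Ax=b$, $-c+A^{\top}y-\eta=0$, $\eta\in\mathcal{K}$, $x\in\mathcal{K}$, $\eta^{\top}x=0$, return $y^{(k)}$ (stop).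
   Formalization: If the nearest point equals w^(k) while x^(k) is infeasible for (P), the hyperplane in step (3) is undefined; the sequence is taken to end there. Continuing with an arbitrary supporting hyperplane would make the claim false. *)

theory Defs
  imports "HOL-Analysis.Analysis" "HOL-Library.Extended_Nat"
begin

text \<open>
  The partition of a vector of \<open>real ^ 'n\<close> into blocks indexed by \<open>'p\<close> is given by two maps:
  \<open>blk j\<close> is the block containing coordinate \<open>j\<close>, and \<open>ld i\<close> is the leading coordinate of
  block \<open>i\<close>. The only requirement, imposed where it is needed, is \<open>blk (ld i) = i\<close>; so
  every block has size at least 1 and all finite families of block sizes occur.
\<close>

definition tail_idx :: "('n::finite \<Rightarrow> 'p::finite) \<Rightarrow> ('p \<Rightarrow> 'n) \<Rightarrow> 'p \<Rightarrow> 'n set" where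
  "tail_idx blk ld i = {j. blk j = i \<and> j \<noteq> ld i}"

definition block_size :: "('n::finite \<Rightarrow> 'p::finite) \<Rightarrow> 'p \<Rightarrow> nat" where
  "block_size blk i = card {j. blk j = i}"

text \<open>For a block of size 1 the sum is empty and the condition reads \<open>0 \<le> x $ ld i\<close>.\<close>

definition soc :: "('n::finite \<Rightarrow> 'p::finite) \<Rightarrow> ('p \<Rightarrow> 'n) \<Rightarrow> (real ^ 'n) set" where
  "soc blk ld = {x. \<forall>i. sqrt (\<Sum>j\<in>tail_idx blk ld i. (x $ j)\<^sup>2) \<le> x $ ld i}"

text \<open>
  A vector with one entry per non-leading coordinate of block \<open>i\<close> is represented by its
  extension by zero to \<open>real ^ 'n\<close>, which preserves the Euclidean norm. For a block of size 1
  the unit ball below is \<open>{0}\<close>.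
\<close>

definition unit_ball :: "('n::finite \<Rightarrow> 'p::finite) \<Rightarrow> ('p \<Rightarrow> 'n) \<Rightarrow> 'p \<Rightarrow> (real ^ 'n) set" where
  "unit_ball blk ld i = {v. (\<forall>j. j \<notin> tail_idx blk ld i \<longrightarrow> v $ j = 0) \<and> norm v \<le> 1}"

text \<open>The number \<open>(1, v\<^sup>T) x\<^sup>i\<close>, where \<open>x\<^sup>i\<close> is the \<open>i\<close>-th block of \<open>x\<close>.\<close>

definition cut ::
  "('n::finite \<Rightarrow> 'p::finite) \<Rightarrow> ('p \<Rightarrow> 'n) \<Rightarrow> 'p \<Rightarrow> real ^ 'n \<Rightarrow> real ^ 'n \<Rightarrow> real" where
  "cut blk ld i v x = x $ ld i + (\<Sum>j\<in>tail_idx blk ld i. v $ j * x $ j)"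

definition cone_of ::
  "('n::finite \<Rightarrow> 'p::finite) \<Rightarrow> ('p \<Rightarrow> 'n) \<Rightarrow> ('p \<Rightarrow> (real ^ 'n) set) \<Rightarrow> (real ^ 'n) set" where
  "cone_of blk ld E =
     {x. \<forall>i. if block_size blk i = 1 then 0 \<le> x $ ld i else \<forall>v\<in>E i. 0 \<le> cut blk ld i v x}"

definition lp_feasible ::
  "real ^ 'n ^ 'm \<Rightarrow> real ^ 'm \<Rightarrow> (real ^ 'n) set \<Rightarrow> (real ^ 'n) set" where
  "lp_feasible A b C = {x. A *v x = b \<and> x \<in> C}"

definition lp_argmax ::
  "real ^ 'n ^ 'm \<Rightarrow> real ^ 'm \<Rightarrow> real ^ 'n \<Rightarrow> (real ^ 'n) set \<Rightarrow> (real ^ 'n) set" where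
  "lp_argmax A b c C = {x. is_arg_max (\<lambda>x. c \<bullet> x) (\<lambda>x. x \<in> lp_feasible A b C) x}"

definition dual_argmin ::
  "real ^ 'n ^ 'm \<Rightarrow> real ^ 'm \<Rightarrow> real ^ 'n \<Rightarrow> (real ^ 'n) set \<Rightarrow> (real ^ 'm) set" where
  "dual_argmin A b c C = {y. is_arg_min (\<lambda>y. b \<bullet> y) (\<lambda>y. transpose A *v y - c \<in> C) y}"

text \<open>The space \<open>real \<times> real ^ 'm\<close> carries the Euclidean norm of dimension \<open>1 + m\<close>.\<close>

definition Abar :: "real ^ 'n ^ 'm \<Rightarrow> real ^ 'n \<Rightarrow> real ^ 'n \<Rightarrow> real \<times> (real ^ 'm)" where
  "Abar A c x = (c \<bullet> x, A *v x)"

definition gamma_line :: "real ^ 'm \<Rightarrow> (real \<times> (real ^ 'm)) set" where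
  "gamma_line b = {(g, b) | g. True}"

text \<open>
  \<open>H\<close> is the supporting hyperplane of \<open>S\<close> at \<open>p\<close> orthogonal to \<open>d\<close>. There is no such
  hyperplane for \<open>d = 0\<close>.
\<close>

definition supporting_hyperplane ::
  "'a::real_inner set \<Rightarrow> 'a \<Rightarrow> 'a \<Rightarrow> 'a set \<Rightarrow> bool" where
  "supporting_hyperplane S p d H \<longleftrightarrow>
     d \<noteq> 0 \<and> p \<in> S \<and> (\<forall>z\<in>S. d \<bullet> z \<le> d \<bullet> p) \<and> H = {z. d \<bullet> z = d \<bullet> p}"

definition admissible_start ::
  "('n::finite \<Rightarrow> 'p::finite) \<Rightarrow> ('p \<Rightarrow> 'n) \<Rightarrow> real ^ 'n ^ 'm \<Rightarrow> real ^ 'm \<Rightarrow> real ^ 'n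
   \<Rightarrow> ('p \<Rightarrow> (real ^ 'n) set) \<Rightarrow> bool" where
  "admissible_start blk ld A b c E0 \<longleftrightarrow>
     (\<forall>i. finite (E0 i) \<and> E0 i \<subseteq> unit_ball blk ld i) \<and>
     lp_argmax A b c (cone_of blk ld E0) \<noteq> {}"

text \<open>
  The first \<open>N\<close> iterates of the ALPN algorithm, with \<open>w\<^sup>k = (g k, b)\<close>; \<open>N = \<infinity>\<close> is a run that
  does not terminate. The choices left open by the algorithm (\<open>x k\<close> and \<open>v k i\<close>) are arbitrary.
  The stopping test and the computation of iterate \<open>Suc k\<close> apply only if that iterate exists.
\<close>

definition alpn_run ::
  "('n::finite \<Rightarrow> 'p::finite) \<Rightarrow> ('p \<Rightarrow> 'n) \<Rightarrow> real ^ 'n ^ 'm \<Rightarrow> real ^ 'm \<Rightarrow> real ^ 'n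
   \<Rightarrow> ('p \<Rightarrow> (real ^ 'n) set) \<Rightarrow> real \<Rightarrow> enat
   \<Rightarrow> (nat \<Rightarrow> 'p \<Rightarrow> (real ^ 'n) set) \<Rightarrow> (nat \<Rightarrow> real) \<Rightarrow> (nat \<Rightarrow> real ^ 'n)
   \<Rightarrow> (nat \<Rightarrow> 'p \<Rightarrow> real ^ 'n) \<Rightarrow> bool" where
  "alpn_run blk ld A b c E0 g0 N E g x v \<longleftrightarrow>
     E 0 = E0 \<and> g 0 = g0 \<and>
     (\<forall>k. enat k < N \<longrightarrow>
        x k \<in> cone_of blk ld (E k) \<and>
        is_arg_min (dist (g k, b)) (\<lambda>z. z \<in> Abar A c ` cone_of blk ld (E k)) (Abar A c (x k))) \<and>
     (\<forall>k. enat (Suc k) < N \<longrightarrow>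
        x k \<notin> lp_feasible A b (soc blk ld) \<and>
        (\<exists>H. supporting_hyperplane (Abar A c ` cone_of blk ld (E k)) (Abar A c (x k))
                ((g k, b) - Abar A c (x k)) H \<and>
             gamma_line b \<inter> H = {(g (Suc k), b)}) \<and>
        (\<forall>i. is_arg_min (\<lambda>u. cut blk ld i u (x k)) (\<lambda>u. u \<in> unit_ball blk ld i) (v k i) \<and>
             E (Suc k) i = E k i \<union> {v k i}))"

definition kkt ::
  "real ^ 'n ^ 'm \<Rightarrow> real ^ 'm \<Rightarrow> real ^ 'n \<Rightarrow> (real ^ 'n) set
   \<Rightarrow> real ^ 'n \<Rightarrow> real ^ 'm \<Rightarrow> real ^ 'n \<Rightarrow> bool" where
  "kkt A b c C x y \<eta> \<longleftrightarrow>
     A *v x = b \<and> - c + transpose A *v y - \<eta> = 0 \<and> \<eta> \<in> C \<and> x \<in> C \<and> \<eta> \<bullet> x = 0"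

text \<open>
  The first \<open>N\<close> iterates \<open>y k\<close> of the dual algorithm along the ALPN iterates \<open>g\<close>, \<open>x\<close>. In the
  break case no \<open>y k\<close> is produced, so it is excluded for every \<open>k\<close> below \<open>N\<close>.
\<close>

definition dual_alpn_run ::
  "('n::finite \<Rightarrow> 'p::finite) \<Rightarrow> ('p \<Rightarrow> 'n) \<Rightarrow> real ^ 'n ^ 'm \<Rightarrow> real ^ 'm \<Rightarrow> real ^ 'n
   \<Rightarrow> enat \<Rightarrow> (nat \<Rightarrow> real) \<Rightarrow> (nat \<Rightarrow> real ^ 'n) \<Rightarrow> (nat \<Rightarrow> real ^ 'm) \<Rightarrow> bool" where
  "dual_alpn_run blk ld A b c N g x y \<longleftrightarrow>
     (\<forall>k. enat k < N \<longrightarrow>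
        \<not> (g k - c \<bullet> x k = 0 \<and> A *v x k \<noteq> b) \<and>
        y k = (if g k - c \<bullet> x k \<noteq> 0 then - ((b - A *v x k) /\<^sub>R (g k - c \<bullet> x k)) else 0)) \<and>
     (\<forall>k. enat (Suc k) < N \<longrightarrow>
        \<not> kkt A b c (soc blk ld) (x k) (y k) (transpose A *v y k - c))"

text \<open>Accumulation points of a sequence with index set \<open>{k. enat k < N}\<close>; none if \<open>N\<close> is finite.\<close>

definition accumulation_point :: "enat \<Rightarrow> (nat \<Rightarrow> 'a::topological_space) \<Rightarrow> 'a \<Rightarrow> bool" where
  "accumulation_point N y l \<longleftrightarrow>
     (\<exists>r. strict_mono r \<and> (\<forall>j. enat (r j) < N) \<and> (y \<circ> r) \<longlonglongrightarrow> l)"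

end

theory Submission
  imports Defs
begin

text \<open>
  Let \<open>d k\<close> be the vector from the projection of \<open>(g k, b)\<close> onto the polyhedral cone to
  \<open>(g k, b)\<close>. It lies in the polar cone and is orthogonal to the projection; if \<open>g k\<close> is at
  least the optimal value, this makes its first entry positive. Dividing by that entry shows that
  \<open>y k\<close> is dual feasible with objective value \<open>g (Suc k)\<close>, so \<open>g\<close> stays above the optimal value.
  Moreover \<open>norm (d k) \<le> g k - g (Suc k)\<close>, so \<open>g\<close> decreases to a limit \<open>\<gamma>\<close>. By Slater's condition
  and full row rank the dual level sets, hence the \<open>y k\<close>, are bounded. Since \<open>d k\<close> tends to 0 and
  each cut added at step \<open>k\<close> is the most violated one, the \<open>x k\<close> are asymptotically feasible;
  compactness of the optimal set yields a feasible point of (P) with value \<open>\<gamma>\<close>. By weak duality,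
  dual feasible accumulation points, which have value \<open>\<gamma>\<close>, are optimal.
\<close>

section \<open>The second-order cone\<close>

lemma cut_eq_inner:
  assumes "v \<in> unit_ball blk ld i"
  shows "cut blk ld i v x = (axis (ld i) 1 + v) \<bullet> x"
proof -
  have "v \<bullet> x = (\<Sum>j\<in>tail_idx blk ld i. v $ j * x $ j)"
    unfolding inner_vec_def inner_real_def
    by (rule sum.mono_neutral_right) (use assms in \<open>auto simp: unit_ball_def\<close>)
  then show ?thesis
    by (simp add: cut_def inner_add_left inner_axis' )
qed

lemma soc_iff_L2_set:
  "x \<in> soc blk ld \<longleftrightarrow> (\<forall>i. L2_set (($) x) (tail_idx blk ld i) \<le> x $ ld i)"
  by (simp add: soc_def L2_set_def)

lemma L2_set_tail_le_1:
  assumes "v \<in> unit_ball blk ld i"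
  shows "L2_set (($) v) (tail_idx blk ld i) \<le> 1"
proof -
  have "L2_set (($) v) (tail_idx blk ld i) \<le> L2_set (($) v) UNIV"
    unfolding L2_set_def by (intro real_sqrt_le_mono sum_mono2) auto
  also have "\<dots> = norm v"
    by (simp add: norm_vec_def L2_set_def)
  finally show ?thesis
    using assms by (simp add: unit_ball_def)
qed

lemma sum_mult_ge_L2_set:
  fixes f g :: "'a \<Rightarrow> real"
  shows "- (L2_set f S * L2_set g S) \<le> (\<Sum>j\<in>S. f j * g j)"
proof -
  have "- (\<Sum>j\<in>S. f j * g j) \<le> (\<Sum>j\<in>S. \<bar>f j\<bar> * \<bar>g j\<bar>)"
    unfolding sum_negf[symmetric] by (rule sum_mono) (simp add: abs_mult[symmetric])
  also have "\<dots> \<le> L2_set f S * L2_set g S"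
    by (rule L2_set_mult_ineq)
  finally show ?thesis by simp
qed

text \<open>Cauchy-Schwarz gives the cuts; conversely, the cut along the negated, normalised tail of
  a block recovers the norm inequality.\<close>

lemma soc_iff_cut:
  "x \<in> soc blk ld \<longleftrightarrow> (\<forall>i. \<forall>v\<in>unit_ball blk ld i. 0 \<le> cut blk ld i v x)"
proof (intro iffI allI ballI)
  fix i v assume x: "x \<in> soc blk ld" and v: "v \<in> unit_ball blk ld i"
  let ?T = "tail_idx blk ld i"
  have "L2_set (($) v) ?T * L2_set (($) x) ?T \<le> 1 * x $ ld i"
    using L2_set_tail_le_1[OF v] x by (intro mult_mono) (auto simp: soc_iff_L2_set)
  then show "0 \<le> cut blk ld i v x"
    using sum_mult_ge_L2_set[of "($) v" ?T "($) x"] by (simp add: cut_def)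
next
  assume cuts: "\<forall>i. \<forall>v\<in>unit_ball blk ld i. 0 \<le> cut blk ld i v x"
  show "x \<in> soc blk ld"
    unfolding soc_iff_L2_set
  proof
    fix i
    let ?T = "tail_idx blk ld i"
    define s where "s = L2_set (($) x) ?T"
    \<comment> \<open>If the tail vanishes, then \<open>s = 0\<close> and division by zero makes
      \<open>v\<close> the zero vector, so membership in the ball needs no case split.\<close>
    define v :: "real ^ 'a" where "v = (\<chi> j. if j \<in> ?T then - (x $ j / s) else 0)"
    have s: "s\<^sup>2 = (\<Sum>j\<in>?T. (x $ j)\<^sup>2)"
      by (simp add: s_def L2_set_def sum_nonneg)
    have "(norm v)\<^sup>2 = (\<Sum>j\<in>UNIV. (v $ j)\<^sup>2)"
      by (simp add: norm_vec_def L2_set_def sum_nonneg)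
    also have "\<dots> = (\<Sum>j\<in>?T. (x $ j / s)\<^sup>2)"
      by (rule sum.mono_neutral_cong_right) (auto simp: v_def)
    also have "\<dots> = s\<^sup>2 / s\<^sup>2"
      unfolding s power_divide sum_divide_distrib ..
    also have "\<dots> \<le> 1"
      by simp
    finally have "norm v \<le> 1"
      using power2_le_imp_le[of "norm v" 1] by simp
    then have "v \<in> unit_ball blk ld i"
      by (auto simp: unit_ball_def v_def)
    then have "0 \<le> cut blk ld i v x"
      using cuts by blast
    also have "cut blk ld i v x = x $ ld i - s\<^sup>2 / s"
      unfolding cut_def s sum_divide_distrib by (simp add: v_def sum_negf power2_eq_square)
    finally show "L2_set (($) x) ?T \<le> x $ ld i"
      by (cases "s = 0") (auto simp: s_def[symmetric] power2_eq_square)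
  qed
qed

lemma closed_soc: "closed (soc blk ld)"
proof -
  have "soc blk ld = (\<Inter>i. \<Inter>v\<in>unit_ball blk ld i. {x. 0 \<le> (axis (ld i) 1 + v) \<bullet> x})"
    by (auto simp: soc_iff_cut cut_eq_inner)
  then show ?thesis
    by (auto intro!: closed_INT simp: closed_halfspace_ge)
qed

lemma soc_add_scaleR:
  assumes "x \<in> soc blk ld" "u \<in> soc blk ld" "0 \<le> t"
  shows "x + t *\<^sub>R u \<in> soc blk ld"
  using assms by (auto simp: soc_iff_cut cut_eq_inner inner_add_right)

text \<open>Blockwise Cauchy-Schwarz: the product of the leading entries dominates the product of
  the tail norms.\<close>

lemma inner_soc_nonneg:
  fixes blk :: "'n::finite \<Rightarrow> 'p::finite"
  assumes blocks: "\<And>i. blk (ld i) = i"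
    and x: "x \<in> soc blk ld" and y: "y \<in> soc blk ld"
  shows "0 \<le> x \<bullet> y"
proof -
  have "x \<bullet> y = (\<Sum>i\<in>UNIV. \<Sum>j\<in>{j. blk j = i}. x $ j * y $ j)"
    by (simp add: inner_vec_def sum.group[where S = UNIV and T = UNIV and g = blk, simplified])
  also have "\<dots> \<ge> 0"
  proof (rule sum_nonneg)
    fix i
    let ?T = "tail_idx blk ld i"
    have "{j. blk j = i} = insert (ld i) ?T"
      using blocks by (auto simp: tail_idx_def)
    then have "(\<Sum>j\<in>{j. blk j = i}. x $ j * y $ j) = x $ ld i * y $ ld i + (\<Sum>j\<in>?T. x $ j * y $ j)"
      by (simp add: tail_idx_def)
    moreover have "L2_set (($) x) ?T * L2_set (($) y) ?T \<le> x $ ld i * y $ ld i"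
      using x y by (intro mult_mono) (auto simp: soc_iff_L2_set intro: order_trans[OF L2_set_nonneg])
    ultimately show "0 \<le> (\<Sum>j\<in>{j. blk j = i}. x $ j * y $ j)"
      using sum_mult_ge_L2_set[of "($) x" ?T "($) y"] by simp
  qed
  finally show ?thesis .
qed

text \<open>By \<open>cut_eq_inner\<close> these vectors are the normals of the cuts; testing
  against them is what yields membership in \<open>soc_self_dual\<close>.\<close>

lemma axis_plus_unit_ball_in_soc:
  assumes blocks: "\<And>i. blk (ld i) = i" and v: "v \<in> unit_ball blk ld i"
  shows "axis (ld i) 1 + v \<in> soc blk ld"
  unfolding soc_iff_L2_set
proof
  fix i'
  let ?e = "axis (ld i) 1 + v" and ?T = "tail_idx blk ld i'"
  show "L2_set (($) ?e) ?T \<le> ?e $ ld i'"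
  proof (cases "i' = i")
    case True
    have "L2_set (($) ?e) ?T = L2_set (($) v) ?T"
      by (rule L2_set_cong) (auto simp: True axis_def tail_idx_def)
    then show ?thesis
      using L2_set_tail_le_1[OF v] v by (simp add: True unit_ball_def axis_def tail_idx_def)
  next
    case False
    have zero: "?e $ j = 0" if "blk j = i'" for j
      using that False v blocks by (auto simp: unit_ball_def axis_def tail_idx_def)
    have "L2_set (($) ?e) ?T = L2_set (\<lambda>_. 0) ?T"
      by (rule L2_set_cong) (auto simp: zero tail_idx_def simp del: vector_add_component)
    then show ?thesis
      using zero[OF blocks] by (simp add: L2_set_def)
  qed
qed

lemma soc_self_dual:
  fixes blk :: "'n::finite \<Rightarrow> 'p::finite"
  assumes blocks: "\<And>i. blk (ld i) = i"
  shows "y \<in> soc blk ld \<longleftrightarrow> (\<forall>x\<in>soc blk ld. 0 \<le> y \<bullet> x)"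
proof
  assume "\<forall>x\<in>soc blk ld. 0 \<le> y \<bullet> x"
  then have "0 \<le> cut blk ld i v y" if "v \<in> unit_ball blk ld i" for i v
    using axis_plus_unit_ball_in_soc[OF blocks that] that
    by (auto simp: cut_eq_inner inner_commute[of y])
  then show "y \<in> soc blk ld"
    by (simp add: soc_iff_cut)
qed (use inner_soc_nonneg[of blk ld, OF blocks] in blast)

section \<open>Polyhedral outer approximations of the cone\<close>

lemma cut_nonneg_if_cone_of:
  assumes blocks: "\<And>i. blk (ld i) = i"
    and x: "x \<in> cone_of blk ld E" and v: "v \<in> E i"
  shows "0 \<le> cut blk ld i v x"
proof (cases "block_size blk i = 1")
  \<comment> \<open>The tail of a block of size 1 is empty, so its cut reduces to the leading
    coordinate.\<close>
  case True
  then obtain j where "{j. blk j = i} = {j}"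
    by (auto simp: block_size_def card_1_singleton_iff)
  then have "{j. blk j = i} = {ld i}"
    using blocks[of i] by (metis mem_Collect_eq singletonD)
  then have "tail_idx blk ld i = {}"
    by (auto simp: tail_idx_def)
  then show ?thesis
    using x True by (auto simp: cone_of_def cut_def)
next
  case False
  then show ?thesis
    using x v by (auto simp: cone_of_def)
qed

lemma soc_subset_cone_of:
  assumes "\<And>i. E i \<subseteq> unit_ball blk ld i"
  shows "soc blk ld \<subseteq> cone_of blk ld E"
proof
  fix x assume x: "x \<in> soc blk ld"
  have "0 \<le> x $ ld i" for i
    using x order_trans[OF L2_set_nonneg] unfolding soc_iff_L2_set by blast
  then show "x \<in> cone_of blk ld E"
    using x assms by (fastforce simp: cone_of_def soc_iff_cut)
qed

lemma cone_of_scaleR: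
  assumes "x \<in> cone_of blk ld E" "0 \<le> t"
  shows "t *\<^sub>R x \<in> cone_of blk ld E"
proof -
  have "cut blk ld i v (t *\<^sub>R x) = t * cut blk ld i v x" for i v
    by (simp add: cut_def distrib_left sum_distrib_left mult.left_commute)
  then show ?thesis
    using assms by (auto simp: cone_of_def split: if_splits)
qed

text \<open>
  Each cut is violated most at \<open>z k\<close> and respected at \<open>z (Suc k)\<close>, while
  \<open>z (Suc k) - z k\<close> vanishes in the limit and all cut normals have norm at most 2.
\<close>

lemma limit_in_soc:
  assumes lim: "z \<longlonglongrightarrow> u"
    and v: "\<And>k i. v k i \<in> unit_ball blk ld i"
    and min: "\<And>k i w. w \<in> unit_ball blk ld i \<Longrightarrow> cut blk ld i (v k i) (z k) \<le> cut blk ld i w (z k)"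
    and pos: "\<And>k i. 0 \<le> cut blk ld i (v k i) (z (Suc k))"
  shows "u \<in> soc blk ld"
  unfolding soc_iff_cut
proof (intro allI ballI)
  fix i w assume w: "w \<in> unit_ball blk ld i"
  have "- (2 * norm (z (Suc k) - z k)) \<le> cut blk ld i w (z k)" for k
  proof -
    let ?e = "axis (ld i) 1 + v k i"
    have "norm ?e \<le> 2"
      using v[of k i] norm_triangle_ineq[of "axis (ld i) (1::real)" "v k i"]
      by (simp add: unit_ball_def)
    then have "?e \<bullet> (z (Suc k) - z k) \<le> 2 * norm (z (Suc k) - z k)"
      by (intro order_trans[OF norm_cauchy_schwarz] mult_right_mono) auto
    then show ?thesis
      using min[OF w, of k] pos[where k = k and i = i] by (simp add: cut_eq_inner[OF v] inner_diff_right)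
  qed
  moreover have "(\<lambda>k. - (2 * norm (z (Suc k) - z k))) \<longlonglongrightarrow> - (2 * norm (u - u))"
    by (intro tendsto_intros LIMSEQ_Suc lim)
  moreover have "(\<lambda>k. cut blk ld i w (z k)) \<longlonglongrightarrow> cut blk ld i w u"
    unfolding cut_eq_inner[OF w] by (intro tendsto_intros lim)
  ultimately show "0 \<le> cut blk ld i w u"
    using LIMSEQ_le by fastforce
qed

section \<open>Dual level sets and recession directions of the optimal set\<close>

lemma inner_transpose_diff:
  fixes A :: "real ^ 'n ^ 'm"
  shows "(transpose A *v y - c) \<bullet> x = y \<bullet> (A *v x) - c \<bullet> x"
  by (simp add: inner_diff_left dot_lmul_matrix)

text \<open>A ball of radius \<open>e\<close> around the Slater point \<open>z\<close> lies in the
  cone, so a dual slack \<open>\<eta>\<close> satisfies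
  \<open>e * norm \<eta> \<le> \<eta> \<bullet> z\<close>, which the level bounds. Full row rank
  makes the transpose injective and carries the bound over to \<open>y\<close>.\<close>

lemma dual_level_bounded:
  fixes blk :: "'n::finite \<Rightarrow> 'p::finite" and A :: "real ^ 'n ^ 'm"
  assumes blocks: "\<And>i. blk (ld i) = i"
    and z: "z \<in> interior (soc blk ld)" "A *v z = b"
    and rank: "rank A = CARD('m)"
  shows "bounded {y. transpose A *v y - c \<in> soc blk ld \<and> b \<bullet> y \<le> r}"
proof -
  obtain e where e: "e > 0" "cball z e \<subseteq> soc blk ld"
    using z(1) by (auto simp: mem_interior_cball)
  have "inj ((*v) (transpose A))"
    using rank full_rank_injective[of "transpose A"] rank_transpose[of A] by metis
  then obtain B where B: "B > 0" "\<And>y. B * norm y \<le> norm (transpose A *v y)"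
    using linear_inj_bounded_below_pos[OF matrix_vector_mul_linear[of "transpose A"]] by metis
  have "norm y \<le> ((r - c \<bullet> z) / e + norm c) / B"
    if y: "transpose A *v y - c \<in> soc blk ld" "b \<bullet> y \<le> r" for y
  proof -
    define \<eta> where "\<eta> = transpose A *v y - c"
    \<comment> \<open>The point of the ball lying farthest against \<open>\<eta>\<close>;
      \<open>sgn 0 = 0\<close> covers the case \<open>\<eta> = 0\<close>.\<close>
    have "z - e *\<^sub>R sgn \<eta> \<in> soc blk ld"
      using e by (intro set_mp[OF e(2)]) (simp add: dist_norm norm_sgn)
    then have "0 \<le> \<eta> \<bullet> (z - e *\<^sub>R sgn \<eta>)"
      using inner_soc_nonneg[of blk ld, OF blocks] y(1) by (simp add: \<eta>_def)
    moreover have "\<eta> \<bullet> sgn \<eta> = norm \<eta>"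
      by (simp add: sgn_div_norm dot_square_norm power2_eq_square divide_simps)
    moreover have "\<eta> \<bullet> z = b \<bullet> y - c \<bullet> z"
      using z(2) unfolding \<eta>_def inner_transpose_diff by (simp add: inner_commute)
    ultimately have "norm \<eta> \<le> (r - c \<bullet> z) / e"
      using e(1) y(2) by (simp add: inner_diff_right field_simps)
    then have "norm (transpose A *v y) \<le> (r - c \<bullet> z) / e + norm c"
      using norm_triangle_ineq[of \<eta> c] by (simp add: \<eta>_def)
    then show ?thesis
      using B(1) B(2)[of y] by (simp add: field_simps)
  qed
  then show ?thesis
    by (intro boundedI) blast
qed


text \<open>All points \<open>z + t *\<^sub>R u\<close> with nonnegative \<open>t\<close> are
  optimal as well, so a nonzero \<open>u\<close> would make the optimal set unbounded.\<close>

lemma recession_direction_eq_0: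
  assumes compact: "compact (lp_argmax A b c (soc blk ld))"
    and z: "z \<in> lp_argmax A b c (soc blk ld)"
    and u: "u \<in> soc blk ld" "A *v u = 0" "c \<bullet> u = 0"
  shows "u = 0"
proof (rule ccontr)
  assume "u \<noteq> 0"
  obtain B where B: "\<And>x. x \<in> lp_argmax A b c (soc blk ld) \<Longrightarrow> norm x \<le> B"
    using compact_imp_bounded[OF compact] by (auto simp: bounded_iff)
  \<comment> \<open>This length forces \<open>z + t *\<^sub>R u\<close> to have norm at least
    \<open>B + 1\<close>.\<close>
  define t where "t = (B + norm z + 1) / norm u"
  have "0 \<le> B"
    using B[OF z] norm_ge_zero order_trans by blast
  then have t: "0 \<le> t" "norm (t *\<^sub>R u) = B + norm z + 1"
    using \<open>u \<noteq> 0\<close> by (auto simp: t_def)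
  have "z + t *\<^sub>R u \<in> lp_argmax A b c (soc blk ld)"
    using z u soc_add_scaleR[OF _ u(1) t(1)]
    by (auto simp: lp_argmax_def is_arg_max_def lp_feasible_def inner_add_right
        matrix_vector_right_distrib matrix_vector_mult_scaleR)
  from B[OF this] show False
    using norm_triangle_ineq2[of "t *\<^sub>R u" "- z"] t(2) by (simp add: add.commute)
qed

section \<open>Runs that do not terminate\<close>

text \<open>Only infinite runs can have accumulation points, and in them every step has a successor.
  The assumption \<open>g0\<close> makes precise how large the initial value must be.\<close>

locale infinite_alpn_run =
  fixes blk :: "'n::finite \<Rightarrow> 'p::finite" and ld :: "'p \<Rightarrow> 'n"
    and A :: "real ^ 'n ^ 'm" and b :: "real ^ 'm" and c :: "real ^ 'n"
    and E0 g0 E g x v y xopt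
  assumes blocks: "\<And>i. blk (ld i) = i"
    and start: "\<And>i. E0 i \<subseteq> unit_ball blk ld i"
    and run: "alpn_run blk ld A b c E0 g0 \<infinity> E g x v"
    and dual_run: "dual_alpn_run blk ld A b c \<infinity> g x y"
    and xopt: "xopt \<in> lp_argmax A b c (soc blk ld)"
    and g0: "c \<bullet> xopt \<le> g0"
begin

lemma v_unit_ball: "v k i \<in> unit_ball blk ld i"
  and v_min: "w \<in> unit_ball blk ld i \<Longrightarrow> cut blk ld i (v k i) (x k) \<le> cut blk ld i w (x k)"
  and E_Suc: "E (Suc k) i = E k i \<union> {v k i}"
  and x_cone_of: "x k \<in> cone_of blk ld (E k)"
  using run by (auto simp: alpn_run_def is_arg_min_def not_less)

lemma E_subset_unit_ball: "E k i \<subseteq> unit_ball blk ld i"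
proof (induction k)
  case 0
  then show ?case using run start by (simp add: alpn_run_def)
next
  case (Suc k)
  then show ?case using v_unit_ball by (auto simp: E_Suc)
qed

lemma v_in_E: "j < k \<Longrightarrow> v j i \<in> E k i"
  by (induction k) (auto simp: E_Suc less_Suc_eq)

lemma soc_subset_cone: "soc blk ld \<subseteq> cone_of blk ld (E k)"
  by (intro soc_subset_cone_of E_subset_unit_ball)

lemma cut_later_nonneg: "j < k \<Longrightarrow> 0 \<le> cut blk ld i (v j i) (x k)"
  using cut_nonneg_if_cone_of[OF blocks x_cone_of v_in_E] .

section \<open>Residuals of the projections and monotonicity of \<open>g\<close>\<close>

definition d :: "nat \<Rightarrow> real \<times> (real ^ 'm)" where
  "d k = (g k, b) - Abar A c (x k)"

lemma d_eq: "d k = (g k - c \<bullet> x k, b - A *v x k)"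
  by (simp add: d_def Abar_def)

lemma d_nonzero: "d k \<noteq> 0"
  and d_supports: "z \<in> cone_of blk ld (E k) \<Longrightarrow> d k \<bullet> Abar A c z \<le> d k \<bullet> Abar A c (x k)"
  and d_next: "d k \<bullet> (g (Suc k), b) = d k \<bullet> Abar A c (x k)"
proof -
  obtain H where H: "supporting_hyperplane (Abar A c ` cone_of blk ld (E k)) (Abar A c (x k)) (d k) H"
    "gamma_line b \<inter> H = {(g (Suc k), b)}"
    using run unfolding alpn_run_def d_def by (metis enat_ord_simps(4) enat.distinct(1))
  then show "d k \<noteq> 0"
    and "z \<in> cone_of blk ld (E k) \<Longrightarrow> d k \<bullet> Abar A c z \<le> d k \<bullet> Abar A c (x k)"
    by (auto simp: supporting_hyperplane_def)
  have "(g (Suc k), b) \<in> H"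
    using H(2) by blast
  then show "d k \<bullet> (g (Suc k), b) = d k \<bullet> Abar A c (x k)"
    using H(1) by (simp add: supporting_hyperplane_def)
qed

text \<open>The functional \<open>d k\<close> attains its maximum over a cone at
  \<open>Abar A c (x k)\<close>; comparison with the multiples 0 and 2 of \<open>x k\<close> forces
  the value 0.\<close>

lemma d_orthogonal: "d k \<bullet> Abar A c (x k) = 0"
proof -
  have scale: "Abar A c (t *\<^sub>R x k) = t *\<^sub>R Abar A c (x k)" for t
    by (simp add: Abar_def matrix_vector_mult_scaleR)
  show ?thesis
    using d_supports[OF cone_of_scaleR[OF x_cone_of, of 0 k]]
      d_supports[OF cone_of_scaleR[OF x_cone_of, of 2 k]]
    unfolding scale by simp
qed

lemma d_soc: "z \<in> soc blk ld \<Longrightarrow> d k \<bullet> Abar A c z \<le> 0"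
  using d_supports soc_subset_cone unfolding d_orthogonal by blast

lemma Abar_xopt: "Abar A c xopt = (c \<bullet> xopt, b)"
  and xopt_soc: "xopt \<in> soc blk ld"
  using xopt by (auto simp: lp_argmax_def is_arg_max_def lp_feasible_def Abar_def)

lemma d_norm: "(g k - c \<bullet> x k) * g k + (b - A *v x k) \<bullet> b = (norm (d k))\<^sup>2"
proof -
  have "d k \<bullet> (g k, b) = d k \<bullet> d k"
    using d_orthogonal[of k] unfolding d_def by (simp add: inner_diff_right)
  then show ?thesis
    by (simp add: d_eq power2_norm_eq_inner)
qed

lemma d_next_eq: "(g k - c \<bullet> x k) * g (Suc k) + (b - A *v x k) \<bullet> b = 0"
  using d_next[of k] unfolding d_orthogonal by (simp add: d_eq)

text \<open>Subtracting the polar inequality at \<open>xopt\<close> from \<open>d_norm\<close> gives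
  \<open>(norm (d k))\<^sup>2 \<le> (g k - c \<bullet> x k) * (g k - c \<bullet>
  xopt)\<close>.\<close>

lemma delta_pos_if:
  assumes "c \<bullet> xopt \<le> g k"
  shows "0 < g k - c \<bullet> x k"
proof -
  have "(g k - c \<bullet> x k) * (c \<bullet> xopt) + (b - A *v x k) \<bullet> b \<le> 0"
    using d_soc[OF xopt_soc, of k] by (simp add: Abar_xopt d_eq)
  moreover have "0 < (norm (d k))\<^sup>2"
    using d_nonzero by simp
  ultimately have "0 < (g k - c \<bullet> x k) * (g k - c \<bullet> xopt)"
    unfolding d_norm[symmetric] by (simp add: right_diff_distrib)
  then show ?thesis
    using assms by (simp add: zero_less_mult_iff)
qed

text \<open>On the line, \<open>d k\<close> vanishes at the next iterate and is nonpositive at the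
  image of \<open>xopt\<close>. Ordering the two points needs a positive first entry of
  \<open>d k\<close>, which the bound at \<open>k\<close> supplies; hence the induction.\<close>

lemma g_ge: "c \<bullet> xopt \<le> g k"
proof (induction k)
  case 0
  then show ?case using run g0 by (simp add: alpn_run_def)
next
  case (Suc k)
  have "(g k - c \<bullet> x k) * (c \<bullet> xopt) + (b - A *v x k) \<bullet> b \<le> 0"
    using d_soc[OF xopt_soc, of k] by (simp add: Abar_xopt d_eq)
  then have "(g k - c \<bullet> x k) * (c \<bullet> xopt) \<le> (g k - c \<bullet> x k) * g (Suc k)"
    using d_next_eq[of k] by simp
  then show ?case
    using delta_pos_if[OF Suc.IH] by simp
qed

lemmas delta_pos = delta_pos_if[OF g_ge]

text \<open>By \<open>d_norm\<close> and \<open>d_next_eq\<close> the squared norm is the first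
  entry of \<open>d k\<close> times the decrease of \<open>g\<close>, and that entry is at most the
  norm.\<close>

lemma norm_d_le: "norm (d k) \<le> g k - g (Suc k)"
proof -
  let ?\<delta> = "g k - c \<bullet> x k"
  have sq: "(norm (d k))\<^sup>2 = ?\<delta> * (g k - g (Suc k))"
    using d_norm[of k] d_next_eq[of k] by (simp add: right_diff_distrib)
  have le: "?\<delta> \<le> norm (d k)"
    using norm_fst_le[of "?\<delta>" "b - A *v x k"] by (simp add: d_eq)
  have "norm (d k) * ?\<delta> \<le> norm (d k) * norm (d k)"
    using le by (rule mult_left_mono) simp
  also have "\<dots> = (g k - g (Suc k)) * ?\<delta>"
    using sq by (simp add: power2_eq_square)
  finally show ?thesis
    using delta_pos[of k] by simp
qed

lemma decseq_g: "decseq g"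
  by (intro decseq_SucI) (metis norm_d_le norm_ge_zero diff_ge_0_iff_ge order_trans)

lemma g_convergent: obtains \<gamma> where "g \<longlonglongrightarrow> \<gamma>"
  using decseq_convergent[OF decseq_g, of "c \<bullet> xopt"] g_ge by blast

section \<open>Feasibility and values of the dual iterates\<close>

lemma y_eq: "y k = - ((b - A *v x k) /\<^sub>R (g k - c \<bullet> x k))"
  using dual_run delta_pos[of k] by (simp add: dual_alpn_run_def)

text \<open>With the denominator cleared, facts about \<open>d k\<close> transfer to
  \<open>y k\<close> by cancelling a positive factor.\<close>

lemma delta_inner_y: "(g k - c \<bullet> x k) * (y k \<bullet> w) = - ((b - A *v x k) \<bullet> w)"
  using delta_pos[of k] by (simp add: y_eq del: scaleR_right_diff_distrib)

lemma inner_y: "b \<bullet> y k = g (Suc k)"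
proof -
  have "(g k - c \<bullet> x k) * (y k \<bullet> b) = (g k - c \<bullet> x k) * g (Suc k)"
    using d_next_eq[of k] unfolding delta_inner_y by simp
  then show ?thesis
    using delta_pos[of k] by (simp add: inner_commute)
qed

text \<open>The polar inequality \<open>d_soc\<close>, divided by the positive first entry of
  \<open>d k\<close>, says that the slack is nonnegative on the cone; self-duality then
  applies.\<close>

lemma y_feasible: "transpose A *v y k - c \<in> soc blk ld"
  unfolding soc_self_dual[of blk ld, OF blocks]
proof
  fix z assume "z \<in> soc blk ld"
  from d_soc[OF this, of k]
  have "(g k - c \<bullet> x k) * (c \<bullet> z) \<le> (g k - c \<bullet> x k) * (y k \<bullet> (A *v z))"
    unfolding delta_inner_y by (simp add: d_eq Abar_def)
  then show "0 \<le> (transpose A *v y k - c) \<bullet> z"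
    using delta_pos[of k] unfolding inner_transpose_diff by simp
qed

text \<open>
  The iterates are homogenised as \<open>(x k, 1) / (1 + norm (x k))\<close>. A limit with last entry 0
  would be a recession direction of the set of optimal solutions.
\<close>

lemma feasible_with_limit_value:
  assumes compact: "compact (lp_argmax A b c (soc blk ld))" and g: "g \<longlonglongrightarrow> \<gamma>"
  obtains z where "z \<in> soc blk ld" "A *v z = b" "c \<bullet> z = \<gamma>"
proof -
  have "(\<lambda>k. g k - g (Suc k)) \<longlonglongrightarrow> \<gamma> - \<gamma>"
    by (intro tendsto_intros LIMSEQ_Suc g)
  then have d: "d \<longlonglongrightarrow> 0"
    using norm_d_le by (intro Lim_null_comparison[where f = d]) auto
  have "(\<lambda>k. g k - fst (d k)) \<longlonglongrightarrow> \<gamma> - fst (0 :: real \<times> (real ^ 'm))"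
    by (intro tendsto_intros g d)
  then have cx: "(\<lambda>k. c \<bullet> x k) \<longlonglongrightarrow> \<gamma>"
    by (simp add: d_eq)
  have "(\<lambda>k. b - snd (d k)) \<longlonglongrightarrow> b - snd (0 :: real \<times> (real ^ 'm))"
    by (intro tendsto_intros d)
  then have Ax: "(\<lambda>k. A *v x k) \<longlonglongrightarrow> b"
    by (simp add: d_eq)
  define s where "s k = 1 / (1 + norm (x k))" for k
  define z where "z k = s k *\<^sub>R x k" for k
  have s: "0 < s k" "norm (z k) + s k = 1" for k
  proof -
    have "0 < 1 + norm (x k)"
      by (simp add: add_pos_nonneg)
    then show "0 < s k" "norm (z k) + s k = 1"
      by (auto simp: s_def z_def field_simps)
  qed
  have "norm (z k, s k) \<le> 1" for k
    using s[of k] norm_Pair_le[of "z k" "s k"] by simp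
  then have "bounded (range (\<lambda>k. (z k, s k)))"
    by (intro boundedI) auto
  then obtain l r where r: "strict_mono r" and l: "((\<lambda>k. (z k, s k)) \<circ> r) \<longlonglongrightarrow> l"
    using bounded_imp_convergent_subsequence by blast
  obtain u t where "l = (u, t)" by fastforce
  then have u: "(\<lambda>n. z (r n)) \<longlonglongrightarrow> u" and t: "(\<lambda>n. s (r n)) \<longlonglongrightarrow> t"
    using tendsto_fst[OF l] tendsto_snd[OF l] by (auto simp: o_def)
  have cut_z: "cut blk ld i w (z k) = s k * cut blk ld i w (x k)" if "w \<in> unit_ball blk ld i" for i w k
    using that by (simp add: cut_eq_inner z_def)
  have "u \<in> soc blk ld"
  proof (rule limit_in_soc[OF u, where v = "\<lambda>n. v (r n)"])
    fix n i w assume "w \<in> unit_ball blk ld i"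
    then show "cut blk ld i (v (r n) i) (z (r n)) \<le> cut blk ld i w (z (r n))"
      using s(1) v_min by (simp add: cut_z v_unit_ball)
  next
    fix n i
    \<comment> \<open>The cut found at \<open>r n\<close> is already imposed at
      \<open>r (Suc n)\<close>, however far apart these indices are.\<close>
    have "r n < r (Suc n)"
      using r by (simp add: strict_mono_Suc_iff)
    then show "0 \<le> cut blk ld i (v (r n) i) (z (r (Suc n)))"
      using cut_later_nonneg s(1)[THEN less_imp_le] by (simp add: cut_z v_unit_ball)
  qed (rule v_unit_ball)
  have "(\<lambda>n. A *v z (r n)) \<longlonglongrightarrow> A *v u"
    by (intro u bounded_linear.tendsto[OF matrix_vector_mul_bounded_linear])
  moreover have "(\<lambda>n. A *v z (r n)) \<longlonglongrightarrow> t *\<^sub>R b"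
    using tendsto_scaleR[OF t LIMSEQ_subseq_LIMSEQ[OF Ax r, unfolded o_def]]
    by (simp add: z_def matrix_vector_mult_scaleR)
  ultimately have Au: "A *v u = t *\<^sub>R b"
    using LIMSEQ_unique by blast
  have "(\<lambda>n. c \<bullet> z (r n)) \<longlonglongrightarrow> c \<bullet> u"
    by (intro tendsto_intros u)
  moreover have "(\<lambda>n. c \<bullet> z (r n)) \<longlonglongrightarrow> t * \<gamma>"
    using tendsto_mult[OF t LIMSEQ_subseq_LIMSEQ[OF cx r, unfolded o_def]]
    by (simp add: z_def)
  ultimately have cu: "c \<bullet> u = t * \<gamma>"
    using LIMSEQ_unique by blast
  \<comment> \<open>The identity \<open>norm (z k) + s k = 1\<close> passes to the limit, so
    \<open>u\<close> and \<open>t\<close> cannot both be zero.\<close>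
  have "(\<lambda>n. norm (z (r n)) + s (r n)) \<longlonglongrightarrow> norm u + t"
    by (intro tendsto_intros u t)
  then have "norm u + t = 1"
    using s(2) LIMSEQ_unique[OF tendsto_const[of 1]] by simp
  then have "t \<noteq> 0"
    using recession_direction_eq_0[OF compact xopt \<open>u \<in> soc blk ld\<close>] Au cu by auto
  moreover have "0 \<le> t"
    using t s(1) by (intro LIMSEQ_le_const) (auto intro: less_imp_le)
  ultimately have "0 < t" by simp
  show thesis
  proof
    have "0 \<in> soc blk ld"
      by (simp add: soc_def)
    from soc_add_scaleR[OF this \<open>u \<in> soc blk ld\<close>, of "1 / t"]
    show "(1 / t) *\<^sub>R u \<in> soc blk ld"
      using \<open>0 < t\<close> by simp
    show "A *v ((1 / t) *\<^sub>R u) = b" "c \<bullet> ((1 / t) *\<^sub>R u) = \<gamma>"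
      using Au cu \<open>0 < t\<close> by (auto simp: matrix_vector_mult_scaleR)
  qed
qed

section \<open>Optimality of accumulation points and boundedness\<close>

lemma accumulation_point_optimal:
  assumes compact: "compact (lp_argmax A b c (soc blk ld))"
    and r: "strict_mono r" and l: "(y \<circ> r) \<longlonglongrightarrow> l"
  shows "l \<in> dual_argmin A b c (soc blk ld)"
proof -
  obtain \<gamma> where g: "g \<longlonglongrightarrow> \<gamma>"
    by (rule g_convergent)
  obtain z where z: "z \<in> soc blk ld" "A *v z = b" "c \<bullet> z = \<gamma>"
    by (rule feasible_with_limit_value[OF compact g])
  have "(\<lambda>n. transpose A *v (y \<circ> r) n - c) \<longlonglongrightarrow> transpose A *v l - c"
    by (intro tendsto_intros l bounded_linear.tendsto[OF matrix_vector_mul_bounded_linear])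
  then have "transpose A *v l - c \<in> soc blk ld"
    by (rule closed_sequentially[OF closed_soc, rotated]) (use y_feasible in simp)
  have "(\<lambda>n. b \<bullet> (y \<circ> r) n) \<longlonglongrightarrow> b \<bullet> l"
    by (intro tendsto_intros l)
  moreover have "(\<lambda>n. b \<bullet> (y \<circ> r) n) \<longlonglongrightarrow> \<gamma>"
    using LIMSEQ_subseq_LIMSEQ[OF LIMSEQ_Suc[OF g] r] by (simp add: inner_y o_def)
  ultimately have bl: "b \<bullet> l = \<gamma>"
    using LIMSEQ_unique by blast
  \<comment> \<open>Weak duality against the feasible point \<open>z\<close> of value
    \<open>\<gamma>\<close>.\<close>
  have "\<gamma> \<le> b \<bullet> y'" if "transpose A *v y' - c \<in> soc blk ld" for y'
    using inner_soc_nonneg[OF blocks that z(1)] z(2,3)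
    unfolding inner_transpose_diff by (simp add: inner_commute)
  then show ?thesis
    using \<open>transpose A *v l - c \<in> soc blk ld\<close>
    by (auto simp: dual_argmin_def is_arg_min_def bl not_less)
qed

text \<open>The values \<open>b \<bullet> y k = g (Suc k)\<close> are at most \<open>g 0\<close>, so
  the whole sequence lies in one dual level set.\<close>

lemma bounded_y:
  assumes z: "z \<in> interior (soc blk ld)" "A *v z = b" and rank: "rank A = CARD('m)"
  shows "bounded (range y)"
proof (rule bounded_subset[OF dual_level_bounded[OF blocks z rank]])
  show "range y \<subseteq> {y. transpose A *v y - c \<in> soc blk ld \<and> b \<bullet> y \<le> g 0}"
    using y_feasible decseq_g by (auto simp: inner_y decseq_def simp del: transpose_matrix_vector)
qed

end

theorem theorem2:
  fixes blk :: "'n::finite \<Rightarrow> 'p::finite" and ld :: "'p \<Rightarrow> 'n"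
    and A :: "real ^ 'n ^ 'm" and b :: "real ^ 'm" and c :: "real ^ 'n"
    and E0 :: "'p \<Rightarrow> (real ^ 'n) set"
  assumes blocks: "\<And>i. blk (ld i) = i"
    and opt_nonempty: "lp_argmax A b c (soc blk ld) \<noteq> {}"
    and opt_compact: "compact (lp_argmax A b c (soc blk ld))"
    and slater: "\<exists>z. z \<in> interior (soc blk ld) \<and> A *v z = b"
    and full_row_rank: "rank A = CARD('m)"
    and start: "admissible_start blk ld A b c E0"
  shows "\<exists>\<Gamma>. \<forall>g0\<ge>\<Gamma>. \<forall>N E g x v y.
           alpn_run blk ld A b c E0 g0 N E g x v \<and> dual_alpn_run blk ld A b c N g x y \<longrightarrow>
             bounded (y ` {k. enat k < N}) \<and>
             (\<forall>l. accumulation_point N y l \<longrightarrow> l \<in> dual_argmin A b c (soc blk ld))"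
proof -
  obtain xopt where xopt: "xopt \<in> lp_argmax A b c (soc blk ld)"
    using opt_nonempty by blast
  obtain z where z: "z \<in> interior (soc blk ld)" "A *v z = b"
    using slater by blast
  \<comment> \<open>The optimal value serves as the threshold \<open>\<Gamma>\<close>.\<close>
  have "bounded (y ` {k. enat k < N}) \<and>
      (\<forall>l. accumulation_point N y l \<longrightarrow> l \<in> dual_argmin A b c (soc blk ld))"
    if g0: "c \<bullet> xopt \<le> g0" and run: "alpn_run blk ld A b c E0 g0 N E g x v"
      and dual_run: "dual_alpn_run blk ld A b c N g x y"
    for g0 N E g x v y
  proof (cases N)
    case (enat n)
    have "\<not> accumulation_point N y l" for l
    proof
      assume "accumulation_point N y l"
      \<comment> \<open>A strictly increasing \<open>r\<close> satisfies \<open>n \<le> r n\<close>,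
        so it leaves the finite index set.\<close>
      then obtain r where "strict_mono r" "enat (r n) < N"
        by (auto simp: accumulation_point_def)
      then show False
        using seq_suble[of r n] enat by simp
    qed
    moreover have "finite {k. enat k < N}"
      by (simp add: enat)
    ultimately show ?thesis
      using finite_imp_bounded by blast
  next
    case infinity
    interpret infinite_alpn_run blk ld A b c E0 g0 E g x v y xopt
      using blocks start run dual_run xopt g0
      by unfold_locales (auto simp: infinity admissible_start_def)
    show ?thesis
      using bounded_y[OF z full_row_rank] accumulation_point_optimal[OF opt_compact]
      by (auto simp: infinity accumulation_point_def)
  qed
  then show ?thesis by blast
qed

end
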